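(* Let $\Sigma$ be the thrice-punctured sphere with its dotted triangulation $\dot\triangle$ having two triangles $v,w$, and let $\lambda,\mu,\nu\in\mathbb Z_N$ be weights with $\lambda+\mu+\nu=0$ assigned to the three punctures. The space $$V_{\dot\triangle}(\lambda,\mu,\nu)=\{\psi\in V_N\otimes V_N:\ \mathsf h_\lambda\psi=q^{2\lambda}\psi,\ \mathsf h_\mu\psi=q^{2\mu}\psi,\ \mathsf h_\nu\psi=q^{2\nu}\psi\}$$ is $1$-dimensional, and spanned by the vector $$|\Psi_{\lambda,\mu,\nu}\rangle=\sum_{m,n\in\mathbb Z_N}\gamma(m-n)^{-1}q^{-2m\lambda-2n\nu}|m,n\rangle,$$ where the first (resp. second) tensor factor corresponds to $v$ (resp. $w$).
   Context: $N$ is a positive odd integer, $q^2$ a primitive $N$-th root of unity, $q=(q^2)^{(N+1)/2}$, so $q^N=1$; $\mathbb Z_N=\mathbb Z/N$, $\gamma(k)=q^{k^2}$. $V_N$ has basis $|k\rangle$, $k\in\mathbb Z_N$, with $\mathsf U|k\rangle=q^{2k}|k\rangle$, $\mathsf P|k\rangle=|k+1\rangle$; on $V_N\otimes V_N$ with basis $|m,n\rangle$, $\mathsf U_v,\mathsf P_v$ act on the first and $\mathsf U_w,\mathsf P_w$ on the second factor. Weyl ordering: if $X_iX_j=q^{2\epsilon_{ij}}X_jX_i$ then $[X_1\cdots X_n]=q^{-\sum_{i<j}\epsilon_{ij}}X_1\cdots X_n$. Triangulation: the square with corners $(0,0),(1,0),(1,1),(0,1)$ and diagonal from $(0,1)$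 to $(1,0)$, with left side glued to top side and bottom side glued to right side, so that $(0,1)$, $(1,0)$ and $(0,0)\sim(1,1)$ are the punctures with weights $\lambda$, $\nu$, $\mu$ respectively. $v$ is the lower-left triangle with dot at $(0,1)$, $w$ the upper-right triangle with dot at $(1,0)$. The homology operators of counterclockwise loops around the three punctures are $$\mathsf h_\lambda=[\mathsf U_v^{-1}\mathsf P_v\mathsf U_w],\qquad \mathsf h_\mu=\mathsf P_v^{-1}\mathsf P_w^{-1},\qquad \mathsf h_\nu=[\mathsf U_v\mathsf U_w^{-1}\mathsf P_w].$$ *)

theory Defs
  imports "HOL-Analysis.Analysis" "Berlekamp_Zassenhaus.Finite_Field"
begin

(* Z/N is the type 'n mod_ring with N = CARD('n); every N >= 1 arises. For N = 1 it is not a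
   comm_ring_1, so the class 1 and numerals are avoided at this type: the residue 1 is
   of_int_mod_ring 1, and exponents are formed from the integer representative below. All powers
   q powi e used here have q^N = 1, so they depend on e only modulo N. *)

abbreviation rep :: "'n::finite mod_ring \<Rightarrow> int" where
  "rep \<equiv> to_int_mod_ring"

definition primitive_root_of_unity :: "nat \<Rightarrow> complex \<Rightarrow> bool" where
  "primitive_root_of_unity N z \<longleftrightarrow> z ^ N = 1 \<and> (\<forall>k. 0 < k \<and> k < N \<longrightarrow> z ^ k \<noteq> 1)"

definition gauss :: "complex \<Rightarrow> 'n::finite mod_ring \<Rightarrow> complex" where
  "gauss q k = q powi ((rep k)\<^sup>2)"

type_synonym 'i operator = "complex ^ 'i \<Rightarrow> complex ^ 'i"

definition ket :: "'i \<Rightarrow> complex ^ 'i::finite" where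
  "ket k = axis k 1"

definition linear_extension :: "('i \<Rightarrow> complex ^ 'i) \<Rightarrow> 'i::finite operator" where
  "linear_extension f \<psi> = (\<Sum>k\<in>UNIV. (\<psi> $ k) *s f k)"

definition U :: "complex \<Rightarrow> 'n::finite mod_ring operator" where
  "U q = linear_extension (\<lambda>k. q powi (2 * rep k) *s ket k)"

definition P :: "'n::finite mod_ring operator" where
  "P = linear_extension (\<lambda>k. ket (k + of_int_mod_ring 1))"

(* The tensor product of complex^'i and complex^'j is complex^('i * 'j), with ket (m, n) the basis
   vector |m,n>; the next two operators are A (x) id and id (x) A. *)

definition on_first :: "'i operator \<Rightarrow> ('i::finite \<times> 'j::finite) operator" where
  "on_first A \<psi> = (\<chi> mn. A (\<chi> m. \<psi> $ (m, snd mn)) $ fst mn)"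

definition on_second :: "'j operator \<Rightarrow> ('i::finite \<times> 'j::finite) operator" where
  "on_second A \<psi> = (\<chi> mn. A (\<chi> n. \<psi> $ (fst mn, n)) $ snd mn)"

definition U\<^sub>v :: "complex \<Rightarrow> ('n::finite mod_ring \<times> 'n mod_ring) operator" where
  "U\<^sub>v q = on_first (U q)"

definition P\<^sub>v :: "('n::finite mod_ring \<times> 'n mod_ring) operator" where
  "P\<^sub>v = on_first P"

definition U\<^sub>w :: "complex \<Rightarrow> ('n::finite mod_ring \<times> 'n mod_ring) operator" where
  "U\<^sub>w q = on_second (U q)"

definition P\<^sub>w :: "('n::finite mod_ring \<times> 'n mod_ring) operator" where
  "P\<^sub>w = on_second P"

definition q_commute :: "complex \<Rightarrow> int \<Rightarrow> 'i::finite operator \<Rightarrow> 'i operator \<Rightarrow> bool" where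
  "q_commute q \<epsilon> X Y \<longleftrightarrow> X \<circ> Y = (\<lambda>\<psi>. q powi (2 * \<epsilon>) *s (Y \<circ> X) \<psi>)"

(* The exponents are determined only modulo N (for nonzero products and q^2 a primitive N-th root
   of unity); as also q^N = 1, the operator described does not depend on their choice. *)
definition weyl_order :: "complex \<Rightarrow> 'i::finite operator list \<Rightarrow> 'i operator" where
  "weyl_order q Xs = (THE Y. \<exists>\<epsilon> :: nat \<Rightarrow> nat \<Rightarrow> int.
     (\<forall>j < length Xs. \<forall>i < j. q_commute q (\<epsilon> i j) (Xs ! i) (Xs ! j)) \<and>
     Y = (\<lambda>\<psi>. q powi (- (\<Sum>j < length Xs. \<Sum>i < j. \<epsilon> i j)) *s foldr (\<circ>) Xs id \<psi>))"

definition h_lam :: "complex \<Rightarrow> ('n::finite mod_ring \<times> 'n mod_ring) operator" where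
  "h_lam q = weyl_order q [inv_into UNIV (U\<^sub>v q), P\<^sub>v, U\<^sub>w q]"

definition h_mu :: "('n::finite mod_ring \<times> 'n mod_ring) operator" where
  "h_mu = inv_into UNIV P\<^sub>v \<circ> inv_into UNIV P\<^sub>w"

definition h_nu :: "complex \<Rightarrow> ('n::finite mod_ring \<times> 'n mod_ring) operator" where
  "h_nu q = weyl_order q [U\<^sub>v q, inv_into UNIV (U\<^sub>w q), P\<^sub>w]"

(* The dotted triangulation of the thrice-punctured sphere is the square with corners
   (0,0), (1,0), (1,1), (0,1) cut along the diagonal from (0,1) to (1,0), the left side glued to
   the top and the bottom to the right side; v is the lower-left triangle with dot at (0,1) and
   w the upper-right one with dot at (1,0). The homology operators above belong to
   counterclockwise loops around the punctures (0,1) (weight lam), (0,0) ~ (1,1) (weight mu)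
   and (1,0) (weight nu). *)
definition V_sphere3 ::
  "complex \<Rightarrow> 'n::finite mod_ring \<Rightarrow> 'n mod_ring \<Rightarrow> 'n mod_ring \<Rightarrow>
     (complex ^ ('n mod_ring \<times> 'n mod_ring)) set" where
  "V_sphere3 q lam mu nu =
     {\<psi>. h_lam q \<psi> = q powi (2 * rep lam) *s \<psi> \<and>
         h_mu \<psi> = q powi (2 * rep mu) *s \<psi> \<and>
         h_nu q \<psi> = q powi (2 * rep nu) *s \<psi>}"

definition Psi ::
  "complex \<Rightarrow> 'n::finite mod_ring \<Rightarrow> 'n mod_ring \<Rightarrow> complex ^ ('n mod_ring \<times> 'n mod_ring)" where
  "Psi q lam nu =
     (\<Sum>m\<in>UNIV. \<Sum>n\<in>UNIV.
        (inverse (gauss q (m - n)) * q powi (- 2 * rep m * rep lam - 2 * rep n * rep nu)) *s ket (m, n))"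

end

theory Submission
  imports Defs
begin

(* Every operator involved is a weighted shift of the basis. The homology equations therefore read
   psi (m - 1, n) = c * psi (m, n), psi (m, n - 1) = d * psi (m, n) with explicit powers c, d of q.
   Psi solves them and vanishes nowhere, so the quotient of any solution by Psi is invariant under
   both shifts, hence constant. The equation for h_mu then holds automatically, as
   lam + mu + nu = 0. *)

section \<open>Representatives of residues and powers of \<open>q\<close>\<close>

abbreviation one_res :: "'n::finite mod_ring" where
  "one_res \<equiv> of_int_mod_ring 1"

lemma rep_of_int_cong: "[rep (of_int_mod_ring i :: 'n::finite mod_ring) = i] (mod int CARD('n))"
  unfolding cong_def by transfer simp

lemma rep_add_cong: "[rep (a + b) = rep a + rep b] (mod int CARD('n))"
  for a b :: "'n::finite mod_ring"
  unfolding cong_def by transfer simp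

lemma rep_diff_cong: "[rep (a - b) = rep a - rep b] (mod int CARD('n))"
  for a b :: "'n::finite mod_ring"
  unfolding cong_def by transfer simp

lemma rep_succ_cong: "[rep (a + one_res) = rep a + 1] (mod int CARD('n))"
  for a :: "'n::finite mod_ring"
  by (rule cong_trans[OF rep_add_cong cong_add[OF cong_refl rep_of_int_cong]])

lemma rep_pred_cong: "[rep (a - one_res) = rep a - 1] (mod int CARD('n))"
  for a :: "'n::finite mod_ring"
  by (rule cong_trans[OF rep_diff_cong cong_diff[OF cong_refl rep_of_int_cong]])

text \<open>If \<open>a = b + N * k\<close>, the surplus factor is a power of
  \<open>q ^ N = 1\<close>. So exponents may be computed with integers although \<open>rep\<close>
  is additive only modulo \<open>N\<close>.\<close>

lemma powi_cong:
  fixes q :: complex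
  assumes "q ^ N = 1" "q \<noteq> 0" "[a = b] (mod int N)"
  shows "q powi a = q powi b"
proof -
  from assms(3) obtain k where "a = b + int N * k"
    by (metis cong_iff_lin cong_sym)
  then show ?thesis
    using assms(1,2) by (simp add: power_int_add power_int_mult)
qed

lemma powi_sum:
  fixes q :: complex
  assumes "q \<noteq> 0" "finite A"
  shows "q powi sum f A = (\<Prod>a\<in>A. q powi f a)"
  using assms(2) by induction (auto simp: power_int_add assms(1))

text \<open>The residue 1 generates the additive group: induction on a natural number
  \<open>k\<close> covers all residues, because each is the class of its nonnegative
  representative.\<close>

lemma mod_ring_shift_invariant:
  fixes f :: "'n::finite mod_ring \<Rightarrow> 'a"
  assumes "\<And>m. f (m - one_res) = f m"
  shows "f m = f 0"
proof -
  have step: "f (x + one_res) = f x" for x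
    using assms[of "x + one_res"] by simp
  have "f (of_int_mod_ring (int k)) = f 0" for k
  proof (induction k)
    case 0
    then show ?case by simp
  next
    case (Suc k)
    have "(of_int_mod_ring (int (Suc k)) :: 'n mod_ring) = of_int_mod_ring (int k) + one_res"
      by transfer (simp add: mod_simps add.commute)
    then show ?case using Suc step by simp
  qed
  moreover have "0 \<le> rep m"
    using range_to_int_mod_ring[where 'a = 'n] by (auto simp: set_eq_iff image_iff)
  ultimately show ?thesis
    by (metis nat_0_le of_int_mod_ring_to_int_mod_ring)
qed

section \<open>The elementary operators and their inverses in coordinates\<close>

lemma linear_extension_nth:
  "linear_extension f \<psi> $ i = (\<Sum>k\<in>UNIV. \<psi> $ k * f k $ i)"
  by (simp add: linear_extension_def)

lemma ket_nth: "ket k $ i = (if i = k then 1 else 0)"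
  by (auto simp: ket_def axis_def)

lemma U_nth: "U q \<psi> $ k = q powi (2 * rep k) * \<psi> $ k"
  by (simp add: U_def linear_extension_nth ket_nth if_distrib mult.commute cong: if_cong)

text \<open>Only the basis vector one step below \<open>k\<close> is carried to
  \<open>ket k\<close>, so raising kets means lowering the index of coordinates.\<close>

lemma P_nth: "P \<psi> $ k = \<psi> $ (k - one_res)"
proof -
  have "k = l + one_res \<longleftrightarrow> l = k - one_res" for l
    by (auto simp: algebra_simps)
  then show ?thesis
    by (simp add: P_def linear_extension_nth ket_nth if_distrib cong: if_cong)
qed

lemma U\<^sub>v_nth: "U\<^sub>v q \<psi> $ (m, n) = q powi (2 * rep m) * \<psi> $ (m, n)"
  by (simp add: U\<^sub>v_def on_first_def U_nth)

lemma U\<^sub>w_nth: "U\<^sub>w q \<psi> $ (m, n) = q powi (2 * rep n) * \<psi> $ (m, n)"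
  by (simp add: U\<^sub>w_def on_second_def U_nth)

lemma P\<^sub>v_nth: "P\<^sub>v \<psi> $ (m, n) = \<psi> $ (m - one_res, n)"
  by (simp add: P\<^sub>v_def on_first_def P_nth)

lemma P\<^sub>w_nth: "P\<^sub>w \<psi> $ (m, n) = \<psi> $ (m, n - one_res)"
  by (simp add: P\<^sub>w_def on_second_def P_nth)

lemma inv_intro:
  assumes "\<And>x. f (g x) = x" "\<And>x. g (f x) = x"
  shows "inv_into UNIV f = g"
  using assms by (intro inv_unique_comp) (auto simp: fun_eq_iff)

lemma inv_U\<^sub>v_nth:
  fixes \<psi> :: "complex ^ ('n::finite mod_ring \<times> 'n mod_ring)"
  assumes "q \<noteq> 0"
  shows "inv_into UNIV (U\<^sub>v q) \<psi> $ (m, n) = q powi (- 2 * rep m) * \<psi> $ (m, n)"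
proof -
  have "inv_into UNIV (U\<^sub>v q) = (\<lambda>\<psi> :: complex ^ ('n::finite mod_ring \<times> 'n mod_ring). \<chi> i. q powi (- 2 * rep (fst i)) * \<psi> $ i)"
    by (rule inv_intro)
      (use assms in \<open>auto simp: vec_eq_iff U\<^sub>v_nth power_int_minus simp flip: mult.assoc\<close>)
  then show ?thesis by simp
qed

lemma inv_U\<^sub>w_nth:
  fixes \<psi> :: "complex ^ ('n::finite mod_ring \<times> 'n mod_ring)"
  assumes "q \<noteq> 0"
  shows "inv_into UNIV (U\<^sub>w q) \<psi> $ (m, n) = q powi (- 2 * rep n) * \<psi> $ (m, n)"
proof -
  have "inv_into UNIV (U\<^sub>w q) = (\<lambda>\<psi> :: complex ^ ('n::finite mod_ring \<times> 'n mod_ring). \<chi> i. q powi (- 2 * rep (snd i)) * \<psi> $ i)"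
    by (rule inv_intro)
      (use assms in \<open>auto simp: vec_eq_iff U\<^sub>w_nth power_int_minus simp flip: mult.assoc\<close>)
  then show ?thesis by simp
qed

lemma inv_P\<^sub>v_nth:
  fixes \<psi> :: "complex ^ ('n::finite mod_ring \<times> 'n mod_ring)"
  shows "inv_into UNIV P\<^sub>v \<psi> $ (m, n) = \<psi> $ (m + one_res, n)"
proof -
  have "inv_into UNIV P\<^sub>v = (\<lambda>\<psi> :: complex ^ ('n::finite mod_ring \<times> 'n mod_ring). \<chi> i. \<psi> $ (fst i + one_res, snd i))"
    by (rule inv_intro) (auto simp: vec_eq_iff P\<^sub>v_nth)
  then show ?thesis by simp
qed

lemma inv_P\<^sub>w_nth:
  fixes \<psi> :: "complex ^ ('n::finite mod_ring \<times> 'n mod_ring)"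
  shows "inv_into UNIV P\<^sub>w \<psi> $ (m, n) = \<psi> $ (m, n + one_res)"
proof -
  have "inv_into UNIV P\<^sub>w = (\<lambda>\<psi> :: complex ^ ('n::finite mod_ring \<times> 'n mod_ring). \<chi> i. \<psi> $ (fst i, snd i + one_res))"
    by (rule inv_intro) (auto simp: vec_eq_iff P\<^sub>w_nth)
  then show ?thesis by simp
qed

(* Nonvanishing of the products fixes q powi (2 * epsilon), and the hypothesis that q is a power
   of q^2 turns this into uniqueness of q powi epsilon. *)
lemma weyl_order_eq:
  fixes Xs :: "'i::finite operator list"
  assumes root: "q = (q\<^sup>2) ^ M" and q0: "q \<noteq> 0"
    and comm: "\<And>i j. i < j \<Longrightarrow> j < length Xs \<Longrightarrow> q_commute q (\<epsilon> i j) (Xs ! i) (Xs ! j)"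
    and nz: "\<And>i j. i < j \<Longrightarrow> j < length Xs \<Longrightarrow> \<exists>\<psi>. (Xs ! j) ((Xs ! i) \<psi>) \<noteq> 0"
  shows "weyl_order q Xs =
    (\<lambda>\<psi>. q powi (- (\<Sum>j < length Xs. \<Sum>i < j. \<epsilon> i j)) *s foldr (\<circ>) Xs id \<psi>)"
proof -
  \<comment> \<open>The exponents themselves are not unique. The definite description is well
    defined because all admissible choices give the same scalar prefactor.\<close>
  have powi_eq: "q powi (- (\<Sum>j < length Xs. \<Sum>i < j. \<epsilon>' i j)) =
      q powi (- (\<Sum>j < length Xs. \<Sum>i < j. \<epsilon> i j))"
    if comm': "\<forall>j < length Xs. \<forall>i < j. q_commute q (\<epsilon>' i j) (Xs ! i) (Xs ! j)" for \<epsilon>'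
  proof -
    have pair: "q powi (\<epsilon>' i j) = q powi (\<epsilon> i j)" if ij: "i < j" "j < length Xs" for i j
    proof -
      obtain \<psi> where \<psi>: "(Xs ! j) ((Xs ! i) \<psi>) \<noteq> 0"
        using nz[OF ij] by blast
      have "q powi (2 * \<epsilon>' i j) *s (Xs ! j) ((Xs ! i) \<psi>) =
          q powi (2 * \<epsilon> i j) *s (Xs ! j) ((Xs ! i) \<psi>)"
        using fun_cong[OF comm[OF ij, unfolded q_commute_def], of \<psi>]
          fun_cong[OF comm'[rule_format, OF ij(2,1), unfolded q_commute_def], of \<psi>]
        by (simp only: comp_apply)
      then have "q powi (2 * \<epsilon>' i j) = q powi (2 * \<epsilon> i j)"
        using \<psi> by simp
      moreover have half: "q powi e = (q powi (2 * e)) ^ M" for e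
      proof -
        have "(q powi (2 * e)) ^ M = ((q\<^sup>2) ^ M) powi e"
          by (simp add: power_int_power power_int_power' ac_simps flip: power_mult)
        then show ?thesis
          unfolding root[symmetric] by (rule sym)
      qed
      ultimately show ?thesis
        by (subst (1 2) half) (rule arg_cong)
    qed
    have "(\<Prod>j < length Xs. \<Prod>i < j. q powi \<epsilon>' i j) =
        (\<Prod>j < length Xs. \<Prod>i < j. q powi \<epsilon> i j)"
      by (intro prod.cong refl pair) auto
    then show ?thesis
      by (simp only: power_int_minus powi_sum[OF q0] finite_lessThan)
  qed
  show ?thesis
    unfolding weyl_order_def
  proof (rule the_equality, goal_cases)
    case 1
    show ?case
      using comm by blast
  next
    case (2 Y)
    then obtain \<epsilon>' where
      comm': "\<forall>j < length Xs. \<forall>i < j. q_commute q (\<epsilon>' i j) (Xs ! i) (Xs ! j)" and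
      Y: "Y = (\<lambda>\<psi>. q powi (- (\<Sum>j < length Xs. \<Sum>i < j. \<epsilon>' i j)) *s foldr (\<circ>) Xs id \<psi>)"
      by blast
    show ?case
      unfolding Y powi_eq[OF comm'] ..
  qed
qed

text \<open>The all-ones vector serves as test vector for products of weighted shifts, which never
  kill it. This supplies the nonvanishing required by \<open>weyl_order_eq\<close>.\<close>

lemma exists_nonzero_image:
  assumes "A (\<chi> _. 1) $ i \<noteq> (0 :: complex)"
  shows "\<exists>\<psi>. A \<psi> \<noteq> 0"
  using assms by (metis zero_index)

section \<open>The homology operators as weighted shifts\<close>

context
  fixes q :: complex and M N :: nat
  assumes root: "q = (q\<^sup>2) ^ M" and qN: "q ^ N = 1" and q0: "q \<noteq> 0"
begin

text \<open>A shift by 1 may make the representative wrap around, which changes the exponent by a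
  multiple of \<open>N\<close>. For \<open>k = - 2\<close> this yields the commutation of the
  inverse of \<open>U\<close> with \<open>P\<close>.\<close>

lemma q_powi_shift:
  fixes m :: "'n::finite mod_ring"
  assumes "N = CARD('n)"
  shows "q powi (k * rep (m - one_res)) = q powi (k * rep m - k)"
    and "q powi (k * rep (m + one_res)) = q powi (k * rep m + k)"
proof -
  have "[k * rep (m - one_res) = k * (rep m - 1)] (mod int N)"
    "[k * rep (m + one_res) = k * (rep m + 1)] (mod int N)"
    using assms rep_pred_cong[of m] rep_succ_cong[of m] by (auto intro: cong_scalar_left)
  then show "q powi (k * rep (m - one_res)) = q powi (k * rep m - k)"
    "q powi (k * rep (m + one_res)) = q powi (k * rep m + k)"
    using qN q0 by (auto dest: powi_cong simp: algebra_simps)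
qed

lemma h_lam_nth:
  fixes \<psi> :: "complex ^ ('n::finite mod_ring \<times> 'n mod_ring)"
  assumes N: "N = CARD('n)"
  shows "h_lam q \<psi> $ (m, n) = q powi (1 - 2 * rep m + 2 * rep n) * \<psi> $ (m - one_res, n)"
proof -
  let ?Xs = "[inv_into UNIV (U\<^sub>v q), P\<^sub>v, U\<^sub>w q] :: ('n mod_ring \<times> 'n mod_ring) operator list"
  \<comment> \<open>Only the first two factors fail to commute: moving \<open>P\<^sub>v\<close> to
    the left past the inverse of \<open>U\<^sub>v\<close> costs \<open>q powi (- 2)\<close>. The
    exponents sum to -1, so Weyl ordering contributes the factor \<open>q\<close>, the 1 in the
    exponent of the claim.\<close>
  let ?e = "\<lambda>i j. if i = 0 \<and> j = 1 then - 1 else 0 :: int"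
  note nths = inv_U\<^sub>v_nth[OF q0] U\<^sub>w_nth P\<^sub>v_nth
  have "q_commute q (?e i j) (?Xs ! i) (?Xs ! j)" if "i < j" "j < length ?Xs" for i j
  proof -
    from that consider "i = 0" "j = 1" | "i = 0" "j = 2" | "i = 1" "j = 2"
      by (force simp: less_Suc_eq)
    then show ?thesis
    proof cases
      case 1
      have "q powi (- 2) * q powi (- 2 * rep (m - one_res)) = q powi (- 2 * rep m)"
        for m :: "'n mod_ring"
        unfolding q_powi_shift[OF N] using q0 by (simp flip: power_int_add)
      with 1 show ?thesis
        by (simp add: q_commute_def fun_eq_iff vec_eq_iff nths)
    qed (simp_all add: q_commute_def fun_eq_iff vec_eq_iff nths)
  qed
  moreover have "\<exists>\<psi>. (?Xs ! j) ((?Xs ! i) \<psi>) \<noteq> 0" if "i < j" "j < length ?Xs" for i j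
    using that q0 by (intro exists_nonzero_image[of _ "(0, 0)"])
      (auto simp: nths less_Suc_eq)
  ultimately have "h_lam q =
      (\<lambda>\<psi>. q powi (- (\<Sum>j < length ?Xs. \<Sum>i < j. ?e i j)) *s foldr (\<circ>) ?Xs id \<psi>)"
    unfolding h_lam_def by (rule weyl_order_eq[OF root q0])
  then show ?thesis
    using q0 by (simp add: nths numeral_3_eq_3 power_int_add power_int_diff power_int_minus field_simps)
qed

lemma h_nu_nth:
  fixes \<psi> :: "complex ^ ('n::finite mod_ring \<times> 'n mod_ring)"
  assumes N: "N = CARD('n)"
  shows "h_nu q \<psi> $ (m, n) = q powi (1 + 2 * rep m - 2 * rep n) * \<psi> $ (m, n - one_res)"
proof -
  let ?Xs = "[U\<^sub>v q, inv_into UNIV (U\<^sub>w q), P\<^sub>w] :: ('n mod_ring \<times> 'n mod_ring) operator list"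
  \<comment> \<open>Now the noncommuting pair is the inverse of \<open>U\<^sub>w\<close> and
    \<open>P\<^sub>w\<close>, at positions 1 and 2, and the prefactor is again
    \<open>q\<close>.\<close>
  let ?e = "\<lambda>i j. if i = 1 \<and> j = 2 then - 1 else 0 :: int"
  note nths = inv_U\<^sub>w_nth[OF q0] U\<^sub>v_nth P\<^sub>w_nth
  have "q_commute q (?e i j) (?Xs ! i) (?Xs ! j)" if "i < j" "j < length ?Xs" for i j
  proof -
    from that consider "i = 0" "j = 1" | "i = 0" "j = 2" | "i = 1" "j = 2"
      by (force simp: less_Suc_eq)
    then show ?thesis
    proof cases
      case 3
      have "q powi (- 2) * q powi (- 2 * rep (m - one_res)) = q powi (- 2 * rep m)"
        for m :: "'n mod_ring"
        unfolding q_powi_shift[OF N] using q0 by (simp flip: power_int_add)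
      with 3 show ?thesis
        by (simp add: q_commute_def fun_eq_iff vec_eq_iff nths)
    qed (simp_all add: q_commute_def fun_eq_iff vec_eq_iff nths)
  qed
  moreover have "\<exists>\<psi>. (?Xs ! j) ((?Xs ! i) \<psi>) \<noteq> 0" if "i < j" "j < length ?Xs" for i j
    using that q0 by (intro exists_nonzero_image[of _ "(0, 0)"])
      (auto simp: nths less_Suc_eq)
  ultimately have "h_nu q =
      (\<lambda>\<psi>. q powi (- (\<Sum>j < length ?Xs. \<Sum>i < j. ?e i j)) *s foldr (\<circ>) ?Xs id \<psi>)"
    unfolding h_nu_def by (rule weyl_order_eq[OF root q0])
  then show ?thesis
    using q0 by (simp add: nths numeral_3_eq_3 numeral_2_eq_2 power_int_add power_int_diff power_int_minus field_simps)
qed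

end

lemma h_mu_nth: "h_mu \<psi> $ (m, n) = \<psi> $ (m + one_res, n + one_res)"
  by (simp add: h_mu_def inv_P\<^sub>v_nth inv_P\<^sub>w_nth)

section \<open>The coordinates of \<open>Psi\<close>\<close>

definition Psi_exponent :: "int \<Rightarrow> int \<Rightarrow> int \<Rightarrow> int \<Rightarrow> int" where
  "Psi_exponent l v m n = - (m - n)\<^sup>2 - 2 * m * l - 2 * n * v"

text \<open>The exponent is taken on integers so that eigenvalue equations become polynomial
  identities. As a polynomial with integer coefficients it tolerates any change of
  representatives.\<close>

lemma Psi_exponent_cong:
  assumes "[m = m'] (mod N)" "[n = n'] (mod N)"
  shows "[Psi_exponent l v m n = Psi_exponent l v m' n'] (mod N)"
  unfolding Psi_exponent_def
  using assms by (intro cong_diff cong_mult cong_pow cong_refl cong_uminus)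

lemma Psi_nth:
  fixes lam nu :: "'n::finite mod_ring"
  assumes "q ^ CARD('n) = 1" "q \<noteq> 0"
  shows "Psi q lam nu $ (m, n) = q powi Psi_exponent (rep lam) (rep nu) (rep m) (rep n)"
proof -
  have "Psi q lam nu $ (m, n) = (\<Sum>m'\<in>UNIV. \<Sum>n'\<in>UNIV. if m = m' \<and> n = n'
      then inverse (gauss q (m' - n')) * q powi (- 2 * rep m' * rep lam - 2 * rep n' * rep nu)
      else 0)"
    by (auto simp: Psi_def ket_nth intro!: sum.cong)
  also have "\<dots> = (\<Sum>m'\<in>UNIV. if m = m' then
      inverse (gauss q (m' - n)) * q powi (- 2 * rep m' * rep lam - 2 * rep n * rep nu) else 0)"
    by (intro sum.cong) auto
  also have "\<dots> = inverse (gauss q (m - n)) * q powi (- 2 * rep m * rep lam - 2 * rep n * rep nu)"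
    by simp
  \<comment> \<open>\<open>gauss\<close> squares the representative of the difference, which agrees
    with the difference of representatives only modulo \<open>N\<close>.\<close>
  also have "gauss q (m - n) = q powi (rep m - rep n)\<^sup>2"
    unfolding gauss_def
    by (rule powi_cong[OF assms]) (intro cong_pow rep_diff_cong)
  finally show ?thesis
    using assms(2) by (simp add: Psi_exponent_def power_int_add power_int_diff power_int_minus field_simps)
qed

section \<open>The joint eigenspace of the homology operators\<close>

theorem proposition5p23:
  fixes q :: complex
    and lam mu nu :: "'n::finite mod_ring"
  assumes "odd CARD('n)"
    and "primitive_root_of_unity CARD('n) (q\<^sup>2)"
    and "q = (q\<^sup>2) ^ ((CARD('n) + 1) div 2)"
    and "lam + mu + nu = 0"
  shows "vec.subspace (V_sphere3 q lam mu nu)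
    \<and> vec.dim (V_sphere3 q lam mu nu) = 1
    \<and> V_sphere3 q lam mu nu = vec.span {Psi q lam nu}"
proof -
  have q2N: "(q\<^sup>2) ^ CARD('n) = 1"
    using assms(2) by (simp add: primitive_root_of_unity_def)
  have q0: "q \<noteq> 0"
    using q2N by (auto simp: power_0_left)
  have qN: "q ^ CARD('n) = 1"
    by (metis assms(3) q2N power_mult mult.commute power_one)
  note h_nths = h_lam_nth[OF assms(3) qN q0 refl] h_mu_nth h_nu_nth[OF assms(3) qN q0 refl]
  let ?l = "rep lam" and ?v = "rep nu" and ?\<Psi> = "Psi q lam nu"
  note Psi_nth = Psi_nth[OF qN q0]
  have Psi_nz: "?\<Psi> $ i \<noteq> 0" for i
    using q0 by (cases i) (simp add: Psi_nth)
  \<comment> \<open>Any integers in the right classes may be used, in particular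
    \<open>rep m - 1\<close> or \<open>rep m + 1\<close> at shifted residues.\<close>
  have Psi_at: "?\<Psi> $ (m, n) = q powi Psi_exponent ?l ?v m' n'"
    if "[rep m = m'] (mod int CARD('n))" "[rep n = n'] (mod int CARD('n))" for m n m' n'
    unfolding Psi_nth by (rule powi_cong[OF qN q0 Psi_exponent_cong[OF that]])
  \<comment> \<open>Lowering \<open>m\<close> by 1 raises the exponent by
    \<open>2 * (m - n) - 1 + 2 * ?l\<close>; the weight of \<open>h_lam\<close> cancels everything
    except \<open>2 * ?l\<close>.\<close>
  have Psi_lam: "q powi (1 - 2 * rep m + 2 * rep n) * ?\<Psi> $ (m - one_res, n) =
      q powi (2 * ?l) * ?\<Psi> $ (m, n)" for m n
    unfolding Psi_at[OF rep_pred_cong cong_refl]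
    unfolding Psi_nth power_int_add[OF disjI1[OF q0], symmetric]
    by (rule arg_cong[where f = "power_int q"])
      (simp add: Psi_exponent_def power2_eq_square algebra_simps)
  \<comment> \<open>Lowering \<open>n\<close> by 1 raises the exponent by
    \<open>- 2 * (m - n) - 1 + 2 * ?v\<close>, and the weight of \<open>h_nu\<close> leaves
    \<open>2 * ?v\<close>.\<close>
  have Psi_nu: "q powi (1 + 2 * rep m - 2 * rep n) * ?\<Psi> $ (m, n - one_res) =
      q powi (2 * ?v) * ?\<Psi> $ (m, n)" for m n
    unfolding Psi_at[OF cong_refl rep_pred_cong]
    unfolding Psi_nth power_int_add[OF disjI1[OF q0], symmetric]
    by (rule arg_cong[where f = "power_int q"])
      (simp add: Psi_exponent_def power2_eq_square algebra_simps)
  \<comment> \<open>The representatives of the weights sum to 0 only modulo \<open>N\<close>, so the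
    relation is transferred to powers of \<open>q\<close> to give \<open>mu_eq\<close>.\<close>
  have "[?l + rep mu + ?v = rep (lam + mu + nu)] (mod int CARD('n))"
    by (meson cong_add cong_refl cong_sym cong_trans rep_add_cong)
  then have "[?l + rep mu + ?v = 0] (mod int CARD('n))"
    by (simp add: assms(4))
  from cong_scalar_left[OF this, of 2]
  have "q powi (2 * (?l + rep mu + ?v)) = q powi (2 * 0)"
    by (rule powi_cong[OF qN q0])
  then have "q powi (2 * rep mu) * q powi (2 * ?l + 2 * ?v) = 1"
    using q0 by (simp flip: power_int_add add: algebra_simps)
  then have mu_eq: "q powi (2 * rep mu) = q powi (- 2 * ?l - 2 * ?v)"
    using q0 by (simp add: power_int_add power_int_diff power_int_minus inverse_eq_divide eq_divide_eq mult.assoc)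
  \<comment> \<open>A simultaneous shift preserves \<open>m - n\<close>, so the Gauss factor is
    unchanged and the linear terms contribute \<open>- 2 * ?l - 2 * ?v\<close>.\<close>
  have Psi_mu: "?\<Psi> $ (m + one_res, n + one_res) = q powi (2 * rep mu) * ?\<Psi> $ (m, n)" for m n
    unfolding mu_eq Psi_at[OF rep_succ_cong rep_succ_cong]
    unfolding Psi_nth power_int_add[OF disjI1[OF q0], symmetric]
    by (rule arg_cong[where f = "power_int q"])
      (simp add: Psi_exponent_def algebra_simps)
  have "V_sphere3 q lam mu nu = vec.span {?\<Psi>}"
    unfolding vec.span_singleton
  proof (intro equalityI subsetI)
    fix \<psi> assume "\<psi> \<in> V_sphere3 q lam mu nu"
    then have lam: "h_lam q \<psi> $ i = q powi (2 * ?l) * \<psi> $ i"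
      and nu: "h_nu q \<psi> $ i = q powi (2 * ?v) * \<psi> $ i" for i
      by (auto simp: V_sphere3_def)
    define \<phi> where "\<phi> = (\<lambda>m n. \<psi> $ (m, n) / ?\<Psi> $ (m, n))"
    \<comment> \<open>\<open>\<psi>\<close> and \<open>?\<Psi>\<close> obey the same recursion with
      coefficients \<open>a\<close> and \<open>b\<close>: cross-multiplication eliminates
      \<open>b\<close>, and cancelling \<open>a\<close> equates the quotients.\<close>
    have ratio: "x / y = x' / y'"
      if "a * x = b * x'" "a * y = b * y'" "y \<noteq> 0" "y' \<noteq> 0" "a \<noteq> 0" for a b x y x' y' :: complex
    proof -
      have "a * (x * y') = a * (x' * y)"
        using that(1,2) by (metis mult.assoc mult.commute)
      then show ?thesis using that(3-5) by (simp add: frac_eq_eq)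
    qed
    have shift_m: "\<phi> (m - one_res) n = \<phi> m n" for m n
      unfolding \<phi>_def using lam[of "(m, n)"] Psi_lam[of m n] Psi_nz q0
      by (intro ratio[of "q powi (1 - 2 * rep m + 2 * rep n)" _ "q powi (2 * ?l)"])
        (auto simp: h_nths)
    have shift_n: "\<phi> m (n - one_res) = \<phi> m n" for m n
      unfolding \<phi>_def using nu[of "(m, n)"] Psi_nu[of m n] Psi_nz q0
      by (intro ratio[of "q powi (1 + 2 * rep m - 2 * rep n)" _ "q powi (2 * ?v)"])
        (auto simp: h_nths)
    have "\<phi> m n = \<phi> 0 0" for m n
    proof -
      have "\<phi> m n = \<phi> 0 n"
        using shift_m by (rule mod_ring_shift_invariant)
      also have "\<phi> 0 n = \<phi> 0 0"
        using shift_n by (rule mod_ring_shift_invariant)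
      finally show ?thesis .
    qed
    moreover have "\<psi> $ (m, n) = \<phi> m n * ?\<Psi> $ (m, n)" for m n
      using Psi_nz by (simp add: \<phi>_def)
    ultimately have "\<psi> $ (m, n) = (\<phi> 0 0 *s ?\<Psi>) $ (m, n)" for m n
      by (metis vector_smult_component)
    then have "\<psi> = \<phi> 0 0 *s ?\<Psi>"
      unfolding vec_eq_iff by (intro allI) (metis surj_pair)
    then show "\<psi> \<in> range (\<lambda>k. k *s ?\<Psi>)"
      by blast
  next
    fix \<psi> assume "\<psi> \<in> range (\<lambda>k. k *s ?\<Psi>)"
    then obtain k where "\<psi> = k *s ?\<Psi>" by blast
    then show "\<psi> \<in> V_sphere3 q lam mu nu"
      by (simp add: V_sphere3_def vec_eq_iff h_nths Psi_lam Psi_mu Psi_nu mult.left_commute[of _ k])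
  qed
  \<comment> \<open>A nonzero generator makes the span exactly one-dimensional.\<close>
  moreover have "?\<Psi> \<noteq> 0"
    using Psi_nz by (metis zero_index)
  ultimately show ?thesis
    by (simp only: vec.subspace_span vec.dim_span vec.dim_singleton simp_thms if_False)
qed

end
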